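(* Let $0\le k\le d$, let $\mathbb{V}\subset C^k$ be the orthogonal complement of $\ker(\Delta_k)$ with respect to $(\cdot,\cdot)_k$, let $\mathbf{f}\in C^k$, $\epsilon>0$, and let $\mathcal{NN}:C^{k-1}\to C^{k-1}$ be a (nonlinear) map such that, for some constant $L_N>0$, $$\|\mathcal{NN}(\mathbf{v})-\mathcal{NN}(\mathbf{w})\|_{k-1}\le L_N\|\mathbf{v}-\mathbf{w}\|_{k-1}\quad\text{for all }\mathbf{v},\mathbf{w}\in C^{k-1},\qquad\text{and}\qquad \mathcal{NN}(\mathbf{0})=\mathbf{0}.$$ If $\epsilon L_N<1$, then there is a unique $\mathbf{u}_k\in\mathbb{V}$ such that $$a(\mathbf{u}_k,\mathbf{v})+\epsilon\,\big(\mathcal{NN}(\mathsf{d}_{k-1}^*\mathbf{u}_k),\mathsf{d}_{k-1}^*\mathbf{v}\big)_{k-1}=(\mathbf{f},\mathbf{v})_k\qquad\text{for all }\mathbf{v}\in\mathbb{V},$$ and it satisfies $$\|\mathbf{u}_k\|_a\le\frac{\|\mathbf{f}\|_{-a}}{1-\epsilon L_N}.$$ Here $a(\mathbf{u},\mathbf{v}):=(\mathsf{d}_{k-1}^*\mathbf{u},\mathsf{d}_{k-1}^*\mathbf{v})_{k-1}+(\mathsf{d}_k\mathbf{u},\mathsf{d}_k\mathbf{v})_{k+1}$ for $\mathbf{u},\mathbf{v}\in\mathbb{V}$, $\|\mathbf{u}\|_a:=\sqrt{a(\mathbf{u},\mathbf{u})}$, and $\|\mathbf{f}\|_{-a}:=\sup_{\mathbf{0}\ne\mathbf{v}\in\mathbb{V}}(\mathbf{f},\mathbf{v})_k/\|\mathbf{v}\|_a$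 (taken to be $0$ if $\mathbb{V}=\{\mathbf{0}\}$).
   Context: Fix $d\ge 1$, a finite node set, and a finite family of cliques (nonempty sets of at most $d+1$ nodes) that is closed under taking nonempty subsets (a simplicial complex). $C^k$ is the finite-dimensional real vector space of $k$-cochains: alternating real-valued functions $\phi$ on ordered $(k+1)$-cliques, $\phi_{i_{\pi(0)}\cdots i_{\pi(k)}}=\operatorname{sgn}(\pi)\,\phi_{i_0\cdots i_k}$. Fixing one orientation for each $(k+1)$-clique identifies $C^k$ with $\mathbb{R}^{N_k}$, where $N_k$ is the number of $(k+1)$-cliques; diagonal matrices and transposes are taken in these coordinates. The coboundary $\delta_k:C^k\to C^{k+1}$ is $$(\delta_k\phi)_{i_0\cdots i_{k+1}}=\sum_{j=0}^{k+1}(-1)^j\phi_{i_0\cdots\widehat{i_j}\cdots i_{k+1}},$$ which satisfies $\delta_{k+1}\circ\delta_k=0$, and $\delta_k^*:C^{k+1}\to C^k$ is its transpose. For $0\le k\le d$, $\mathbf{B}_k$ and $\mathbf{D}_k$ are arbitrary diagonal matrices with positive diagonal entries acting on $C^k$. The data-driven operators are $\mathsf{d}_k:=\mathbf{B}_{k+1}\delta_k\mathbf{B}_k^{-1}:C^k\to C^{k+1}$, $\mathsf{d}_k^*:=\mathbf{D}_k^{-1}\delta_k^*\mathbf{D}_{k+1}:C^{k+1}\to C^k$, and $\Delta_k:=\mathsf{d}_{k-1}\mathsf{d}_{k-1}^*+\mathsf{d}_k^*\mathsf{d}_k$. The inner product on $C^k$ is $(\mathbf{x},\mathbf{y})_k:=\mathbf{x}^{T}\mathbf{D}_k\mathbf{B}_k^{-1}\mathbf{y}$,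 with induced norm $\|\cdot\|_k$. Convention: $C^{-1}=C^{d+1}=0$, so $\mathsf{d}_{-1}$, $\mathsf{d}_{-1}^*$, $\mathsf{d}_d$, $\mathsf{d}_d^*$ are zero maps. The variational equation is the weak form of $\Delta_k\mathbf{u}_k+\epsilon\,\mathsf{d}_{k-1}\,\mathcal{NN}(\mathsf{d}_{k-1}^*\mathbf{u}_k)=\mathbf{f}$. *)

theory Defs
  imports "HOL-Analysis.Analysis" "HOL-Library.Function_Algebras"
begin

(* Degrees are integers, so that degree -1 needs no special treatment. A cochain of degree k is a
   function on lists of nodes that vanishes outside the ordered (k+1)-cliques. *)

record 'v complex_data =
  nodes :: "'v set"
  dimension :: nat
  cliques :: "'v set set"
  orient :: "'v set \<Rightarrow> 'v list"             (* the chosen ordering of each clique *)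
  Bdiag :: "int \<Rightarrow> 'v set \<Rightarrow> real"        (* diagonal of B_k *)
  Ddiag :: "int \<Rightarrow> 'v set \<Rightarrow> real"        (* diagonal of D_k *)

definition cells :: "('v, 'm) complex_data_scheme \<Rightarrow> int \<Rightarrow> 'v set set" where
  "cells X k = {\<sigma> \<in> cliques X. int (card \<sigma>) = k + 1}"

definition complex_data :: "('v, 'm) complex_data_scheme \<Rightarrow> bool" where
  "complex_data X \<longleftrightarrow>
     1 \<le> dimension X \<and>
     finite (nodes X) \<and>
     (\<forall>\<sigma>\<in>cliques X. \<sigma> \<subseteq> nodes X \<and> \<sigma> \<noteq> {} \<and> card \<sigma> \<le> dimension X + 1) \<and>
     (\<forall>\<sigma>\<in>cliques X. \<forall>\<tau>. \<tau> \<subseteq> \<sigma> \<and> \<tau> \<noteq> {} \<longrightarrow> \<tau> \<in> cliques X) \<and>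
     (\<forall>\<sigma>\<in>cliques X. distinct (orient X \<sigma>) \<and> set (orient X \<sigma>) = \<sigma>) \<and>
     (\<forall>k. 0 \<le> k \<and> k \<le> int (dimension X) \<longrightarrow>
        (\<forall>\<sigma>\<in>cells X k. 0 < Bdiag X k \<sigma> \<and> 0 < Ddiag X k \<sigma>))"

definition ordered_cliques :: "('v, 'm) complex_data_scheme \<Rightarrow> int \<Rightarrow> 'v list set" where
  "ordered_cliques X k = {xs. distinct xs \<and> set xs \<in> cells X k}"

definition cochains :: "('v, 'm) complex_data_scheme \<Rightarrow> int \<Rightarrow> ('v list \<Rightarrow> real) set" where
  "cochains X k = {\<phi>.
     (\<forall>xs. xs \<notin> ordered_cliques X k \<longrightarrow> \<phi> xs = 0) \<and>
     (\<forall>xs\<in>ordered_cliques X k. \<forall>\<pi>. \<pi> permutes {..<length xs} \<longrightarrow>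
        \<phi> (permute_list \<pi> xs) = of_int (sign \<pi>) * \<phi> xs)}"

(* The coordinate of a cochain at the cell \<sigma> is its value at orient X \<sigma>; of_coords is the inverse of
   the resulting identification of C^k with real vectors indexed by the cells (lemmas
   of_coords_in_cochains, of_coords_orient and of_coords_coords). *)

definition orientation_sign :: "('v, 'm) complex_data_scheme \<Rightarrow> 'v list \<Rightarrow> real" where
  "orientation_sign X xs =
     of_int (sign (THE \<pi>. \<pi> permutes {..<length xs} \<and> xs = permute_list \<pi> (orient X (set xs))))"

definition of_coords ::
  "('v, 'm) complex_data_scheme \<Rightarrow> int \<Rightarrow> ('v set \<Rightarrow> real) \<Rightarrow> 'v list \<Rightarrow> real" where
  "of_coords X k c =
     (\<lambda>xs. if xs \<in> ordered_cliques X k then orientation_sign X xs * c (set xs) else 0)"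

(* A matrix is indexed by (row cell, column cell). *)

definition matrix_of :: "('v, 'm) complex_data_scheme \<Rightarrow> int \<Rightarrow>
    (('v list \<Rightarrow> real) \<Rightarrow> 'v list \<Rightarrow> real) \<Rightarrow> 'v set \<Rightarrow> 'v set \<Rightarrow> real" where
  "matrix_of X k T = (\<lambda>\<tau> \<sigma>. T (of_coords X k (\<lambda>\<rho>. if \<rho> = \<sigma> then 1 else 0)) (orient X \<tau>))"

definition matrix_op :: "('v, 'm) complex_data_scheme \<Rightarrow> int \<Rightarrow> int \<Rightarrow>
    ('v set \<Rightarrow> 'v set \<Rightarrow> real) \<Rightarrow> ('v list \<Rightarrow> real) \<Rightarrow> 'v list \<Rightarrow> real" where
  "matrix_op X k l M \<phi> = of_coords X l (\<lambda>\<tau>. \<Sum>\<sigma>\<in>cells X k. M \<tau> \<sigma> * \<phi> (orient X \<sigma>))"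

definition diag_op :: "('v, 'm) complex_data_scheme \<Rightarrow> int \<Rightarrow>
    ('v set \<Rightarrow> real) \<Rightarrow> ('v list \<Rightarrow> real) \<Rightarrow> 'v list \<Rightarrow> real" where
  "diag_op X k b = matrix_op X k k (\<lambda>\<tau> \<sigma>. if \<tau> = \<sigma> then b \<sigma> else 0)"

definition coboundary ::
  "('v, 'm) complex_data_scheme \<Rightarrow> int \<Rightarrow> ('v list \<Rightarrow> real) \<Rightarrow> 'v list \<Rightarrow> real" where
  "coboundary X k \<phi> =
     (\<lambda>xs. if xs \<in> ordered_cliques X (k + 1)
           then \<Sum>j<length xs. (- 1) ^ j * \<phi> (take j xs @ drop (Suc j) xs) else 0)"

definition coboundary_transpose ::
  "('v, 'm) complex_data_scheme \<Rightarrow> int \<Rightarrow> ('v list \<Rightarrow> real) \<Rightarrow> 'v list \<Rightarrow> real" where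
  "coboundary_transpose X k =
     matrix_op X (k + 1) k (\<lambda>\<sigma> \<tau>. matrix_of X k (coboundary X k) \<tau> \<sigma>)"

definition dd :: "('v, 'm) complex_data_scheme \<Rightarrow> int \<Rightarrow> ('v list \<Rightarrow> real) \<Rightarrow> 'v list \<Rightarrow> real" where
  "dd X k = diag_op X (k + 1) (Bdiag X (k + 1)) \<circ> coboundary X k
            \<circ> diag_op X k (\<lambda>\<sigma>. inverse (Bdiag X k \<sigma>))"

definition dd_star :: "('v, 'm) complex_data_scheme \<Rightarrow> int \<Rightarrow> ('v list \<Rightarrow> real) \<Rightarrow> 'v list \<Rightarrow> real" where
  "dd_star X k = diag_op X k (\<lambda>\<sigma>. inverse (Ddiag X k \<sigma>)) \<circ> coboundary_transpose X k
                 \<circ> diag_op X (k + 1) (Ddiag X (k + 1))"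

definition hodge_laplacian ::
  "('v, 'm) complex_data_scheme \<Rightarrow> int \<Rightarrow> ('v list \<Rightarrow> real) \<Rightarrow> 'v list \<Rightarrow> real" where
  "hodge_laplacian X k u = dd X (k - 1) (dd_star X (k - 1) u) + dd_star X k (dd X k u)"

definition cochain_inner ::
  "('v, 'm) complex_data_scheme \<Rightarrow> int \<Rightarrow> ('v list \<Rightarrow> real) \<Rightarrow> ('v list \<Rightarrow> real) \<Rightarrow> real" where
  "cochain_inner X k x y =
     (\<Sum>\<sigma>\<in>cells X k.
        x (orient X \<sigma>) * (Ddiag X k \<sigma> * inverse (Bdiag X k \<sigma>)) * y (orient X \<sigma>))"

definition cochain_norm :: "('v, 'm) complex_data_scheme \<Rightarrow> int \<Rightarrow> ('v list \<Rightarrow> real) \<Rightarrow> real" where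
  "cochain_norm X k x = sqrt (cochain_inner X k x x)"

definition laplacian_kernel :: "('v, 'm) complex_data_scheme \<Rightarrow> int \<Rightarrow> ('v list \<Rightarrow> real) set" where
  "laplacian_kernel X k = {w \<in> cochains X k. hodge_laplacian X k w = 0}"

definition kernel_complement :: "('v, 'm) complex_data_scheme \<Rightarrow> int \<Rightarrow> ('v list \<Rightarrow> real) set" where
  "kernel_complement X k =
     {u \<in> cochains X k. \<forall>w\<in>laplacian_kernel X k. cochain_inner X k u w = 0}"

definition energy ::
  "('v, 'm) complex_data_scheme \<Rightarrow> int \<Rightarrow> ('v list \<Rightarrow> real) \<Rightarrow> ('v list \<Rightarrow> real) \<Rightarrow> real" where
  "energy X k u v =
     cochain_inner X (k - 1) (dd_star X (k - 1) u) (dd_star X (k - 1) v)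
     + cochain_inner X (k + 1) (dd X k u) (dd X k v)"

definition energy_norm :: "('v, 'm) complex_data_scheme \<Rightarrow> int \<Rightarrow> ('v list \<Rightarrow> real) \<Rightarrow> real" where
  "energy_norm X k u = sqrt (energy X k u u)"

definition dual_energy_norm :: "('v, 'm) complex_data_scheme \<Rightarrow> int \<Rightarrow> ('v list \<Rightarrow> real) \<Rightarrow> real" where
  "dual_energy_norm X k f =
     (if kernel_complement X k = {0} then 0
      else SUP v\<in>kernel_complement X k - {0}. cochain_inner X k f v / energy_norm X k v)"

definition weak_solution ::
  "('v, 'm) complex_data_scheme \<Rightarrow> int \<Rightarrow> (('v list \<Rightarrow> real) \<Rightarrow> 'v list \<Rightarrow> real) \<Rightarrow> real \<Rightarrow>
    ('v list \<Rightarrow> real) \<Rightarrow> ('v list \<Rightarrow> real) \<Rightarrow> bool" where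
  "weak_solution X k NN \<epsilon> f u \<longleftrightarrow>
     u \<in> kernel_complement X k \<and>
     (\<forall>v\<in>kernel_complement X k.
        energy X k u v
        + \<epsilon> * cochain_inner X (k - 1) (NN (dd_star X (k - 1) u)) (dd_star X (k - 1) v)
        = cochain_inner X k f v)"

lemma cells_outside:
  assumes "complex_data X" "k < 0 \<or> int (dimension X) < k"
  shows "cells X k = {}"
proof -
  have "0 \<le> k \<and> k \<le> int (dimension X)" if "\<sigma> \<in> cells X k" for \<sigma>
  proof -
    have s: "\<sigma> \<subseteq> nodes X" "\<sigma> \<noteq> {}" "card \<sigma> \<le> dimension X + 1" "int (card \<sigma>) = k + 1"
      and "finite (nodes X)"
      using that assms(1) unfolding complex_data_def cells_def by auto
    then have "0 < card \<sigma>" by (meson card_gt_0_iff finite_subset)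
    with s show ?thesis by linarith
  qed
  with assms(2) show ?thesis by fastforce
qed

lemma cochains_outside:
  assumes "complex_data X" "k < 0 \<or> int (dimension X) < k"
  shows "cochains X k = {0}"
  using cells_outside[OF assms] by (auto simp: cochains_def ordered_cliques_def zero_fun_def)

lemma permute_list_eqD:
  assumes "distinct xs" "p permutes {..<length xs}" "q permutes {..<length xs}"
    "permute_list p xs = permute_list q xs"
  shows "p = q"
proof
  fix i
  show "p i = q i"
  proof (cases "i < length xs")
    case True
    then have "xs ! p i = xs ! q i"
      using assms(2-4) by (metis permute_list_nth)
    then show ?thesis
      using True assms(1-3) by (metis lessThan_iff nth_eq_iff_index_eq permutes_in_image)
  next
    case False
    then show ?thesis using assms(2,3) by (simp add: permutes_def)
  qed
qed

lemma orientation_sign_permute: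
  assumes "complex_data X" "\<sigma> \<in> cliques X" "p permutes {..<length (orient X \<sigma>)}"
  shows "orientation_sign X (permute_list p (orient X \<sigma>)) = of_int (sign p)"
proof -
  let ?o = "orient X \<sigma>"
  have o: "distinct ?o" "set ?o = \<sigma>" using assms(1,2) by (auto simp: complex_data_def)
  have s: "set (permute_list p ?o) = \<sigma>" using assms(3) o by simp
  have "(THE \<pi>. \<pi> permutes {..<length (permute_list p ?o)} \<and>
      permute_list p ?o = permute_list \<pi> (orient X (set (permute_list p ?o)))) = p"
    unfolding s using assms(3) permute_list_eqD[OF o(1)] by (intro the_equality) auto
  then show ?thesis by (simp add: orientation_sign_def)
qed

lemma ordered_clique_permute:
  assumes "complex_data X" "xs \<in> ordered_cliques X k"
  obtains p where "p permutes {..<length (orient X (set xs))}"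
    "permute_list p (orient X (set xs)) = xs"
proof -
  have "set xs \<in> cliques X" "distinct xs"
    using assms(2) by (auto simp: ordered_cliques_def cells_def)
  then have "mset xs = mset (orient X (set xs))"
    using assms(1) by (simp add: complex_data_def set_eq_iff_mset_eq_distinct[symmetric])
  then show thesis using mset_eq_permutation that by metis
qed

lemma of_coords_in_cochains:
  assumes "complex_data X"
  shows "of_coords X k c \<in> cochains X k"
proof -
  have "of_coords X k c (permute_list \<pi> xs) = of_int (sign \<pi>) * of_coords X k c xs"
    if xs: "xs \<in> ordered_cliques X k" and \<pi>: "\<pi> permutes {..<length xs}" for xs \<pi>
  proof -
    obtain p where p: "p permutes {..<length (orient X (set xs))}"
      "permute_list p (orient X (set xs)) = xs"
      using ordered_clique_permute[OF assms xs] .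
    then have len: "length (orient X (set xs)) = length xs" by (metis length_permute_list)
    have cl: "set xs \<in> cliques X" using xs by (simp add: ordered_cliques_def cells_def)
    have pp: "permutation p" "permutation \<pi>"
      using p(1) \<pi> by (auto simp: permutation_permutes)
    have eq: "permute_list \<pi> xs = permute_list (p \<circ> \<pi>) (orient X (set xs))"
      using permute_list_compose[of \<pi> "orient X (set xs)" p] p \<pi> len by simp
    have "orientation_sign X (permute_list \<pi> xs) = of_int (sign \<pi>) * orientation_sign X xs"
      using orientation_sign_permute[OF assms cl, of "p \<circ> \<pi>"] orientation_sign_permute[OF assms cl p(1)]
        permutes_compose[OF \<pi>, of p] p eq len pp
      by (simp add: sign_compose)
    moreover have "permute_list \<pi> xs \<in> ordered_cliques X k"
      using xs \<pi> by (simp add: ordered_cliques_def)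
    ultimately show ?thesis using xs \<pi> by (simp add: of_coords_def)
  qed
  then show ?thesis by (auto simp: cochains_def of_coords_def)
qed

lemma of_coords_orient:
  assumes "complex_data X" "\<sigma> \<in> cells X k"
  shows "of_coords X k c (orient X \<sigma>) = c \<sigma>"
proof -
  have "\<sigma> \<in> cliques X" using assms(2) by (simp add: cells_def)
  then show ?thesis
    using orientation_sign_permute[OF assms(1), of \<sigma> id] assms
    by (auto simp: of_coords_def ordered_cliques_def complex_data_def permutes_id sign_id)
qed

lemma of_coords_coords:
  assumes "complex_data X" "\<phi> \<in> cochains X k"
  shows "of_coords X k (\<lambda>\<sigma>. \<phi> (orient X \<sigma>)) = \<phi>"
proof
  fix xs
  show "of_coords X k (\<lambda>\<sigma>. \<phi> (orient X \<sigma>)) xs = \<phi> xs"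
  proof (cases "xs \<in> ordered_cliques X k")
    case True
    obtain p where p: "p permutes {..<length (orient X (set xs))}"
      "permute_list p (orient X (set xs)) = xs"
      using ordered_clique_permute[OF assms(1) True] .
    have cl: "set xs \<in> cliques X" using True by (simp add: ordered_cliques_def cells_def)
    have "orient X (set xs) \<in> ordered_cliques X k"
      using True assms(1) cl by (simp add: ordered_cliques_def complex_data_def)
    then have "\<phi> xs = of_int (sign p) * \<phi> (orient X (set xs))"
      using assms(2) p unfolding cochains_def by (metis (mono_tags, lifting) mem_Collect_eq)
    then show ?thesis
      using orientation_sign_permute[OF assms(1) cl p(1)] p(2) True by (simp add: of_coords_def)
  next
    case False
    then show ?thesis using assms(2) by (simp add: of_coords_def cochains_def)
  qed
qed

end

theory Submission
  imports Defs
begin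

text \<open>
  The equation is a Lipschitz perturbation of a linear one, and the perturbation is small in the
  energy norm. The inner products of the spaces of cochains, and hence the energy, are symmetric
  positive semidefinite forms. The energy is definite on the complement \<open>V\<close> of the kernel of the
  Laplacian: zero energy forces \<open>d\<^sup>* u = 0\<close> and \<open>d u = 0\<close>, so \<open>u\<close> lies in the kernel and is therefore
  orthogonal to itself (\<open>energy_definite\<close>). So \<open>V\<close> with the energy is a finite-dimensional Hilbert
  space.

  For a fixed \<open>u\<close>, the Riesz representation theorem yields the unique \<open>\<Phi> u \<in> V\<close> with
  \<open>a (\<Phi> u, v) = (f, v) - \<epsilon> (NN (d\<^sup>* u), d\<^sup>* v)\<close> for all \<open>v \<in> V\<close>, and the weak solutions are the fixed
  points of \<open>\<Phi>\<close>. Since \<open>\<parallel>d\<^sup>* u\<parallel> \<le> \<parallel>u\<parallel>\<close>, with the energy norm on the right, Cauchy-Schwarz in degree \<open>k - 1\<close>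
  shows that \<open>\<Phi>\<close> is a contraction with factor \<open>\<epsilon> L\<^sub>N < 1\<close>, and Banach's fixed point theorem applies
  (\<open>Lipschitz_perturbation\<close>). Testing the equation with \<open>v = u\<close> and using \<open>NN 0 = 0\<close> gives
  \<open>\<parallel>u\<parallel>\<^sup>2 \<le> \<parallel>f\<parallel>\<^sub>* \<parallel>u\<parallel> + \<epsilon> L\<^sub>N \<parallel>u\<parallel>\<^sup>2\<close>, with the dual norm of \<open>f\<close>, which is the bound.

  Riesz representation and completeness both follow from a finite set \<open>E\<close> of vectors of \<open>V\<close> such that
  every \<open>u \<in> V\<close> is the sum of the \<open>a (u, e) e\<close> over \<open>e \<in> E\<close> (\<open>frame_exists\<close>).
\<close>

section \<open>Symmetric positive semidefinite forms\<close>

text \<open>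
  The formulas for the cochain operators are linear in all functions on lists of nodes. Their
  forms are therefore semidefinite on this whole space, and definite only on subspaces of cochains.
\<close>
locale psd_form = vector_space scale
  for scale :: "real \<Rightarrow> 'b::ab_group_add \<Rightarrow> 'b" (infixr \<open>\<odot>\<close> 75) +
  fixes ip :: "'b \<Rightarrow> 'b \<Rightarrow> real"
  assumes add_left: "ip (u + v) w = ip u w + ip v w"
    and scale_left: "ip (c \<odot> u) w = c * ip u w"
    and ip_commute: "ip u v = ip v u"
    and ip_nonneg: "0 \<le> ip u u"
begin

definition seminorm :: "'b \<Rightarrow> real" where
  "seminorm u = sqrt (ip u u)"

lemma module_hom_left: "module_hom (\<odot>) (*) (\<lambda>u. ip u w)"
  by unfold_locales (simp_all add: algebra_simps add_left scale_left)

lemma module_hom_right: "module_hom (\<odot>) (*) (ip w)"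
  using module_hom_left[of w] by (simp add: ip_commute[of _ w])

lemmas zero_left = module_hom.zero[OF module_hom_left]
lemmas diff_left = module_hom.diff[OF module_hom_left]
lemmas neg_left = module_hom.neg[OF module_hom_left]
lemmas sum_left = module_hom.sum[OF module_hom_left]
lemmas zero_right = module_hom.zero[OF module_hom_right]
lemmas add_right = module_hom.add[OF module_hom_right]
lemmas diff_right = module_hom.diff[OF module_hom_right]
lemmas neg_right = module_hom.neg[OF module_hom_right]
lemmas scale_right = module_hom.scale[OF module_hom_right]
lemmas sum_right = module_hom.sum[OF module_hom_right]

lemma seminorm_nonneg: "0 \<le> seminorm u"
  by (simp add: seminorm_def ip_nonneg)

lemma seminorm_power2: "(seminorm u)\<^sup>2 = ip u u"
  by (simp add: seminorm_def ip_nonneg)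

lemma seminorm_zero: "seminorm 0 = 0"
  by (simp add: seminorm_def zero_left)

lemma seminorm_minus: "seminorm (- u) = seminorm u"
  by (simp add: seminorm_def neg_left neg_right)

lemma seminorm_scale: "seminorm (c \<odot> u) = \<bar>c\<bar> * seminorm u"
  by (simp add: seminorm_def scale_left scale_right real_sqrt_mult flip: mult.assoc)

lemma Cauchy_Schwarz: "\<bar>ip u v\<bar> \<le> seminorm u * seminorm v"
proof -
  have quad: "0 \<le> ip u u - 2 * t * ip u v + t\<^sup>2 * ip v v" for t
    using ip_nonneg[of "u - t \<odot> v"] ip_commute[of v u]
    by (simp add: diff_left diff_right scale_left scale_right power2_eq_square algebra_simps)
  have "(ip u v)\<^sup>2 \<le> ip u u * ip v v"
  proof (cases "ip v v = 0")
    case True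
    \<comment> \<open>The quadratic in \<open>t\<close> is then affine and bounded below, so its slope vanishes.\<close>
    have "ip u v = 0"
      using quad[of "(ip u u + 1) / (2 * ip u v)"] True by (cases "ip u v = 0") auto
    then show ?thesis using True by simp
  next
    case False
    then show ?thesis
      using quad[of "ip u v / ip v v"] ip_nonneg[of v]
      by (simp add: field_simps power2_eq_square)
  qed
  then have "sqrt ((ip u v)\<^sup>2) \<le> sqrt (ip u u * ip v v)"
    by (rule real_sqrt_le_mono)
  then show ?thesis by (simp add: seminorm_def real_sqrt_mult)
qed

lemma seminorm_triangle: "seminorm (u + v) \<le> seminorm u + seminorm v"
proof (rule power2_le_imp_le)
  have "ip u v \<le> seminorm u * seminorm v"
    using Cauchy_Schwarz[of u v] by linarith
  then show "(seminorm (u + v))\<^sup>2 \<le> (seminorm u + seminorm v)\<^sup>2"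
    using ip_commute[of v u] by (simp add: seminorm_power2 power2_sum add_left add_right)
qed (simp add: seminorm_nonneg)

lemma seminorm_sum_le: "seminorm (sum g A) \<le> (\<Sum>x\<in>A. seminorm (g x))"
proof (induction A rule: infinite_finite_induct)
  case (insert x A)
  then show ?case using seminorm_triangle[of "g x" "sum g A"] by simp
qed (simp_all add: seminorm_zero)

end

section \<open>Definite forms on finite-dimensional subspaces\<close>

text \<open>
  Finite dimension enters as a finite set \<open>\<Lambda>\<close> of linear functionals that separates the points of \<open>V\<close>.
  In the application these are the evaluations at the oriented cells: they separate all
  cochains, hence every subspace, whereas a basis of the subspace is not at hand.
\<close>
locale definite_form = psd_form +
  fixes V :: "'a set" and \<Lambda> :: "('a \<Rightarrow> real) set"
  assumes subspace_V: "subspace V"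
    and definite: "u \<in> V \<Longrightarrow> ip u u = 0 \<Longrightarrow> u = 0"
    and finite_functionals: "finite \<Lambda>"
    and functionals: "\<phi> \<in> \<Lambda> \<Longrightarrow> module_hom (\<odot>) (*) \<phi>"
    and separating: "u \<in> V \<Longrightarrow> \<forall>\<phi>\<in>\<Lambda>. \<phi> u = 0 \<Longrightarrow> u = 0"
begin

text \<open>
  Gram-Schmidt, by induction on the number of separating functionals: the zero set \<open>W'\<close> of one
  functional \<open>\<phi>\<close> is separated by the remaining ones, and if \<open>W'\<close> is not all of \<open>W\<close>, then it has
  codimension one, so that a single unit vector orthogonal to \<open>W'\<close> completes its frame to one of \<open>W\<close>.
\<close>
lemma frame_exists_aux:
  assumes "finite \<Gamma>" "\<Gamma> \<subseteq> \<Lambda>" "subspace W" "W \<subseteq> V"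
    and "\<And>u. u \<in> W \<Longrightarrow> \<forall>\<phi>\<in>\<Gamma>. \<phi> u = 0 \<Longrightarrow> u = 0"
  shows "\<exists>E. finite E \<and> E \<subseteq> W \<and> (\<forall>u\<in>W. u = (\<Sum>e\<in>E. ip u e \<odot> e))"
  using assms
proof (induction \<Gamma> arbitrary: W)
  case empty
  then have "\<forall>u\<in>W. u = 0" by blast
  then show ?case by (intro exI[of _ "{}"]) simp
next
  case (insert \<phi> \<Gamma>)
  have \<phi>: "module_hom (\<odot>) (*) \<phi>" using insert.prems(1) functionals by blast
  define W' where "W' = {u \<in> W. \<phi> u = 0}"
  have sW': "subspace W'"
    using insert.prems(2) by (auto simp: W'_def subspace_def
        module_hom.zero[OF \<phi>] module_hom.add[OF \<phi>] module_hom.scale[OF \<phi>])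
  have "\<exists>E. finite E \<and> E \<subseteq> W' \<and> (\<forall>u\<in>W'. u = (\<Sum>e\<in>E. ip u e \<odot> e))"
    using insert.prems sW' by (intro insert.IH) (auto simp: W'_def)
  then obtain E where E: "finite E" "E \<subseteq> W'"
    and expand: "\<And>u. u \<in> W' \<Longrightarrow> u = (\<Sum>e\<in>E. ip u e \<odot> e)" by blast
  show ?case
  proof (cases "W' = W")
    case True
    then show ?thesis using E expand by blast
  next
    case False
    then obtain w where w: "w \<in> W" "\<phi> w \<noteq> 0" by (auto simp: W'_def)
    \<comment> \<open>One step of Gram-Schmidt: remove from \<open>w\<close> its component in \<open>W'\<close> and normalise.\<close>
    define p where "p = (\<Sum>e\<in>E. ip w e \<odot> e)"
    define z where "z = w - p"
    have p: "p \<in> W'"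
      unfolding p_def using E(2) by (auto intro!: subspace_sum[OF sW'] subspace_scale[OF sW'])
    have z: "z \<in> W" "\<phi> z \<noteq> 0"
      using w p insert.prems(2) by (auto simp: z_def W'_def subspace_diff module_hom.diff[OF \<phi>])
    have orth: "ip u z = 0" if "u \<in> W'" for u
    proof -
      have "ip u w = ip (\<Sum>e\<in>E. ip u e \<odot> e) w" using expand[OF that] by simp
      also have "\<dots> = ip u p"
        by (simp add: p_def sum_left sum_right scale_left scale_right ip_commute[of w] mult.commute)
      finally show ?thesis by (simp add: z_def diff_right)
    qed
    have "z \<noteq> 0" using z(2) module_hom.zero[OF \<phi>] by auto
    then have zz: "ip z z > 0"
      using definite[of z] z(1) insert.prems(3) ip_nonneg[of z] by fastforce
    define e where "e = inverse (seminorm z) \<odot> z"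
    have sz: "seminorm z > 0" using zz by (simp add: seminorm_def)
    have e: "e \<in> W" "\<phi> e \<noteq> 0"
      using z sz insert.prems(2) by (auto simp: e_def subspace_scale module_hom.scale[OF \<phi>])
    have ee: "ip e e = 1"
      using sz zz seminorm_power2[of z]
      by (simp add: e_def scale_left scale_right power2_eq_square field_simps)
    have orth_e: "ip u e = 0" if "u \<in> W'" for u
      using orth[OF that] by (simp add: e_def scale_right)
    have notin: "e \<notin> E" using e E(2) by (auto simp: W'_def)
    have "u = (\<Sum>e'\<in>insert e E. ip u e' \<odot> e')" if u: "u \<in> W" for u
    proof -
      \<comment> \<open>This \<open>t\<close> makes \<open>u - t e\<close> a zero of \<open>\<phi>\<close>; as \<open>e\<close> is a unit vector orthogonal to \<open>W'\<close>, it is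
        also the coefficient \<open>ip u e\<close>.\<close>
      define t where "t = \<phi> u / \<phi> e"
      define u' where "u' = u - t \<odot> e"
      have u': "u' \<in> W'"
        using u e insert.prems(2)
        by (simp add: u'_def W'_def t_def subspace_diff subspace_scale
            module_hom.diff[OF \<phi>] module_hom.scale[OF \<phi>])
      have ue: "ip u e = t"
        using orth_e[OF u'] by (simp add: u'_def diff_left scale_left ee)
      have "ip u' e' = ip u e'" if "e' \<in> E" for e'
        using orth_e[of e'] that E(2) ip_commute[of e e'] by (auto simp: u'_def diff_left scale_left)
      then have "u' = (\<Sum>e'\<in>E. ip u e' \<odot> e')"
        using expand[OF u'] by simp
      then have "u = t \<odot> e + (\<Sum>e'\<in>E. ip u e' \<odot> e')"
        by (simp add: u'_def algebra_simps)
      then show ?thesis using E(1) notin by (simp add: ue)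
    qed
    moreover have "finite (insert e E)" "insert e E \<subseteq> W"
      using E e by (auto simp: W'_def)
    ultimately show ?thesis by blast
  qed
qed

lemma frame_exists:
  obtains E where "finite E" "E \<subseteq> V" "\<And>u. u \<in> V \<Longrightarrow> u = (\<Sum>e\<in>E. ip u e \<odot> e)"
proof -
  have "\<exists>E. finite E \<and> E \<subseteq> V \<and> (\<forall>u\<in>V. u = (\<Sum>e\<in>E. ip u e \<odot> e))"
    by (rule frame_exists_aux[OF finite_functionals]) (auto simp: subspace_V separating)
  then show thesis using that by blast
qed

text \<open>Applying \<open>F\<close> to the frame expansion of \<open>v\<close> shows what the representing vector must be.\<close>
lemma Riesz:
  assumes F: "module_hom (\<odot>) (*) F"
  shows "\<exists>g\<in>V. \<forall>v\<in>V. ip g v = F v"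
proof -
  obtain E where E: "finite E" "E \<subseteq> V" "\<And>u. u \<in> V \<Longrightarrow> u = (\<Sum>e\<in>E. ip u e \<odot> e)"
    using frame_exists by blast
  show ?thesis
  proof (intro bexI ballI)
    show "(\<Sum>e\<in>E. F e \<odot> e) \<in> V"
      using E(2) by (auto intro!: subspace_sum[OF subspace_V] subspace_scale[OF subspace_V])
    fix v assume "v \<in> V"
    then have "F v = F (\<Sum>e\<in>E. ip v e \<odot> e)" using E(3) by simp
    also have "\<dots> = ip v (\<Sum>e\<in>E. F e \<odot> e)"
      by (simp add: module_hom.sum[OF F] module_hom.scale[OF F] sum_right scale_right mult.commute)
    finally show "ip (\<Sum>e\<in>E. F e \<odot> e) v = F v" by (simp add: ip_commute)
  qed
qed

definition form_dist :: "'a \<Rightarrow> 'a \<Rightarrow> real" where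
  "form_dist u v = seminorm (u - v)"

sublocale Metric_space V form_dist
proof
  fix u v w
  show "0 \<le> form_dist u v" by (simp add: form_dist_def seminorm_nonneg)
  show "form_dist u v = form_dist v u"
    using seminorm_minus[of "u - v"] by (simp add: form_dist_def)
  show "form_dist u w \<le> form_dist u v + form_dist v w"
    using seminorm_triangle[of "u - v" "v - w"] by (simp add: form_dist_def)
  show "form_dist u v = 0 \<longleftrightarrow> u = v" if "u \<in> V" "v \<in> V"
    using definite[of "u - v"] subspace_diff[OF subspace_V that]
    by (auto simp: form_dist_def seminorm_def zero_left)
qed

text \<open>
  By Cauchy-Schwarz the coefficients \<open>ip (x n) e\<close> of a Cauchy sequence are Cauchy sequences of real
  numbers, and their limits are the coefficients of a limit of \<open>x\<close>.
\<close>
lemma mcomplete: mcomplete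
  unfolding mcomplete_def
proof (intro allI impI)
  fix x :: "nat \<Rightarrow> 'a"
  assume "MCauchy x"
  then have xV: "x n \<in> V"
    and cauchy: "\<epsilon> > 0 \<Longrightarrow> \<exists>N. \<forall>n n'. N \<le> n \<longrightarrow> N \<le> n' \<longrightarrow> form_dist (x n) (x n') < \<epsilon>" for n \<epsilon>
    by (auto simp: MCauchy_def)
  obtain E where E: "finite E" "E \<subseteq> V" "\<And>u. u \<in> V \<Longrightarrow> u = (\<Sum>e\<in>E. ip u e \<odot> e)"
    using frame_exists by blast
  have "convergent (\<lambda>n. ip (x n) e)" for e
  proof (rule Cauchy_convergent, rule metric_CauchyI)
    fix \<epsilon> :: real assume "\<epsilon> > 0"
    \<comment> \<open>Adding 1 allows the division by \<open>s\<close> when \<open>seminorm e = 0\<close>.\<close>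
    define s where "s = seminorm e + 1"
    have s: "0 < s" "seminorm e \<le> s" using seminorm_nonneg[of e] by (auto simp: s_def)
    with \<open>\<epsilon> > 0\<close> obtain N where N: "\<And>m n. N \<le> m \<Longrightarrow> N \<le> n \<Longrightarrow> form_dist (x m) (x n) < \<epsilon> / s"
      using cauchy[of "\<epsilon> / s"] by auto
    have "dist (ip (x m) e) (ip (x n) e) < \<epsilon>" if mn: "N \<le> m" "N \<le> n" for m n
    proof -
      have "\<bar>ip (x m - x n) e\<bar> \<le> form_dist (x m) (x n) * seminorm e"
        unfolding form_dist_def by (rule Cauchy_Schwarz)
      also have "\<dots> \<le> form_dist (x m) (x n) * s"
        using s by (intro mult_left_mono) auto
      also have "\<dots> < \<epsilon>"
        using N[OF mn] s by (simp add: field_simps)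
      finally show ?thesis by (simp add: dist_real_def diff_left)
    qed
    then show "\<exists>M. \<forall>m\<ge>M. \<forall>n\<ge>M. dist (ip (x m) e) (ip (x n) e) < \<epsilon>" by blast
  qed
  then obtain c where c: "\<And>e. (\<lambda>n. ip (x n) e) \<longlonglongrightarrow> c e"
    unfolding convergent_def by metis
  define l where "l = (\<Sum>e\<in>E. c e \<odot> e)"
  have "l \<in> V"
    unfolding l_def using E(2) by (auto intro!: subspace_sum[OF subspace_V] subspace_scale[OF subspace_V])
  have le: "form_dist (x n) l \<le> (\<Sum>e\<in>E. \<bar>ip (x n) e - c e\<bar> * seminorm e)" for n
  proof -
    have "x n - l = (\<Sum>e\<in>E. (ip (x n) e - c e) \<odot> e)"
      using E(3)[OF xV[of n]] by (simp add: l_def algebra_simps sum_subtractf)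
    then show ?thesis
      using seminorm_sum_le[of "\<lambda>e. (ip (x n) e - c e) \<odot> e" E]
      by (simp add: form_dist_def seminorm_scale)
  qed
  have "(\<lambda>n. \<Sum>e\<in>E. \<bar>ip (x n) e - c e\<bar> * seminorm e) \<longlonglongrightarrow> (\<Sum>e\<in>E. \<bar>c e - c e\<bar> * seminorm e)"
    by (intro tendsto_intros c)
  then have "(\<lambda>n. \<Sum>e\<in>E. \<bar>ip (x n) e - c e\<bar> * seminorm e) \<longlonglongrightarrow> 0"
    by simp
  then have "(\<lambda>n. form_dist (x n) l) \<longlonglongrightarrow> 0"
    by (rule Lim_null_comparison[rotated]) (use le in auto)
  then have "limitin mtopology x l sequentially"
    using \<open>l \<in> V\<close> xV by (simp add: limitin_metric_dist_null)
  then show "\<exists>l. limitin mtopology x l sequentially" by blast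
qed

text \<open>
  A nonlinear analogue of the Lax-Milgram theorem: \<open>\<Phi> u\<close> is the Riesz representative of \<open>F - N u\<close>,
  the solutions are the fixed points of \<open>\<Phi>\<close>, and the Lipschitz bound, tested with
  \<open>v = \<Phi> u - \<Phi> w\<close>, makes \<open>\<Phi>\<close> a contraction.
\<close>
theorem Lipschitz_perturbation:
  assumes F: "module_hom (\<odot>) (*) F"
    and N: "\<And>u. u \<in> V \<Longrightarrow> module_hom (\<odot>) (*) (N u)"
    and Lip: "\<And>u w v. u \<in> V \<Longrightarrow> w \<in> V \<Longrightarrow> v \<in> V \<Longrightarrow>
      \<bar>N u v - N w v\<bar> \<le> q * seminorm (u - w) * seminorm v"
    and "0 \<le> q" "q < 1"
  shows "\<exists>!u. u \<in> V \<and> (\<forall>v\<in>V. ip u v + N u v = F v)"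
proof -
  have "module_hom (\<odot>) (*) (\<lambda>v. F v - N u v)" if "u \<in> V" for u
    by unfold_locales (simp_all add: module_hom.add[OF F] module_hom.scale[OF F]
        module_hom.add[OF N[OF that]] module_hom.scale[OF N[OF that]] algebra_simps)
  then have "\<forall>u\<in>V. \<exists>g. g \<in> V \<and> (\<forall>v\<in>V. ip g v = F v - N u v)"
    using Riesz by (simp add: Bex_def)
  then obtain \<Phi> where "\<forall>u\<in>V. \<Phi> u \<in> V \<and> (\<forall>v\<in>V. ip (\<Phi> u) v = F v - N u v)"
    by (rule bchoice[THEN exE])
  then have \<Phi>: "\<And>u. u \<in> V \<Longrightarrow> \<Phi> u \<in> V"
    "\<And>u v. u \<in> V \<Longrightarrow> v \<in> V \<Longrightarrow> ip (\<Phi> u) v = F v - N u v"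
    by blast+
  have contr: "form_dist (\<Phi> u) (\<Phi> w) \<le> q * form_dist u w" if "u \<in> V" "w \<in> V" for u w
  proof -
    let ?z = "\<Phi> u - \<Phi> w"
    have z: "?z \<in> V" using \<Phi>(1) that by (simp add: subspace_diff[OF subspace_V])
    have "(seminorm ?z)\<^sup>2 = N w ?z - N u ?z"
      using \<Phi>(2)[OF that(1) z] \<Phi>(2)[OF that(2) z] by (simp add: seminorm_power2 diff_left)
    also have "\<dots> \<le> q * seminorm (u - w) * seminorm ?z"
      using Lip[OF that z] by linarith
    finally show ?thesis
      using seminorm_nonneg[of ?z] seminorm_nonneg[of "u - w"] \<open>0 \<le> q\<close>
      by (cases "seminorm ?z = 0") (auto simp: form_dist_def power2_eq_square)
  qed
  have fix_iff: "\<Phi> u = u \<longleftrightarrow> (\<forall>v\<in>V. ip u v + N u v = F v)" if u: "u \<in> V" for u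
  proof
    assume "\<Phi> u = u"
    then show "\<forall>v\<in>V. ip u v + N u v = F v" using \<Phi>(2)[OF u] by auto
  next
    assume *: "\<forall>v\<in>V. ip u v + N u v = F v"
    have d: "\<Phi> u - u \<in> V" using \<Phi>(1) u by (simp add: subspace_diff[OF subspace_V])
    then have "ip u (\<Phi> u - u) = F (\<Phi> u - u) - N u (\<Phi> u - u)" using * by force
    then have "ip (\<Phi> u - u) (\<Phi> u - u) = 0"
      using \<Phi>(2)[OF u d] by (simp add: diff_left)
    then show "\<Phi> u = u" using definite[OF d] by simp
  qed
  have "V \<noteq> {}" using subspace_0[OF subspace_V] by blast
  moreover have maps: "\<Phi> \<in> V \<rightarrow> V" using \<Phi>(1) by blast
  ultimately obtain u where "u \<in> V" "\<Phi> u = u"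
    using Banach_fixedpoint_thm[OF mcomplete _ _ \<open>q < 1\<close> contr] by blast
  moreover have "w = u" if "w \<in> V" "\<Phi> w = w" for w
    by (rule contraction_imp_unique_fixpoint[OF that(2) \<open>\<Phi> u = u\<close> maps \<open>q < 1\<close> contr])
      (use that \<open>u \<in> V\<close> in auto)
  ultimately show ?thesis using fix_iff by metis
qed

end

section \<open>Cochains as a vector space with a form\<close>

definition pscale :: "real \<Rightarrow> ('i \<Rightarrow> real) \<Rightarrow> 'i \<Rightarrow> real" where
  "pscale c u = (\<lambda>x. c * u x)"

lemma pscale_apply [simp]: "pscale c u x = c * u x"
  by (simp add: pscale_def)

interpretation pointwise: vector_space pscale
  by unfold_locales (simp_all add: fun_eq_iff algebra_simps)

lemma module_hom_evaluation: "module_hom pscale (*) (\<lambda>u. u x)"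
  by unfold_locales (simp_all add: algebra_simps)

lemma module_hom_matrix_op: "module_hom pscale pscale (matrix_op X k l M)"
  by unfold_locales
    (simp_all add: fun_eq_iff matrix_op_def of_coords_def algebra_simps sum.distrib sum_distrib_left)

lemma module_hom_coboundary: "module_hom pscale pscale (coboundary X k)"
  by unfold_locales
    (simp_all add: fun_eq_iff coboundary_def algebra_simps sum.distrib sum_distrib_left)

lemma module_hom_dd: "module_hom pscale pscale (dd X k)"
  unfolding dd_def diag_op_def
  by (intro module_hom_compose[of pscale pscale _ pscale]
      module_hom_matrix_op module_hom_coboundary)

lemma module_hom_dd_star: "module_hom pscale pscale (dd_star X k)"
  unfolding dd_star_def diag_op_def coboundary_transpose_def
  by (intro module_hom_compose[of pscale pscale _ pscale]
      module_hom_matrix_op)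

lemma dd_in_cochains: "complex_data X \<Longrightarrow> dd X k u \<in> cochains X (k + 1)"
  by (simp add: dd_def diag_op_def matrix_op_def of_coords_in_cochains)

lemma dd_star_in_cochains: "complex_data X \<Longrightarrow> dd_star X k u \<in> cochains X k"
  by (simp add: dd_star_def diag_op_def matrix_op_def of_coords_in_cochains)

lemma subspace_cochains: "pointwise.subspace (cochains X k)"
  by (auto simp: pointwise.subspace_def cochains_def algebra_simps)

lemma finite_cells:
  assumes "complex_data X"
  shows "finite (cells X k)"
proof (rule finite_subset)
  show "cells X k \<subseteq> Pow (nodes X)" "finite (Pow (nodes X))"
    using assms by (auto simp: complex_data_def cells_def)
qed

lemma cochain_eq_0I:
  assumes "complex_data X" "u \<in> cochains X k" "\<And>\<sigma>. \<sigma> \<in> cells X k \<Longrightarrow> u (orient X \<sigma>) = 0"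
  shows "u = 0"
proof -
  have "of_coords X k (\<lambda>\<sigma>. u (orient X \<sigma>)) = 0"
    using assms(3) by (auto simp: of_coords_def ordered_cliques_def)
  then show ?thesis using of_coords_coords[OF assms(1,2)] by simp
qed

text \<open>Positivity of the diagonals is known only in degrees from 0 to the dimension; in every other
  degree there are no cells.\<close>
lemma weight_pos:
  assumes "complex_data X" "\<sigma> \<in> cells X k"
  shows "0 < Ddiag X k \<sigma> * inverse (Bdiag X k \<sigma>)"
proof -
  have "0 \<le> k \<and> k \<le> int (dimension X)"
    using cells_outside[OF assms(1), of k] assms(2) by force
  then show ?thesis using assms by (simp add: complex_data_def)
qed

lemma psd_form_cochain_inner:
  assumes "complex_data X"
  shows "psd_form pscale (cochain_inner X k)"
proof
  fix u v w c
  show "cochain_inner X k (u + v) w = cochain_inner X k u w + cochain_inner X k v w"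
    by (simp add: cochain_inner_def algebra_simps sum.distrib)
  show "cochain_inner X k (pscale c u) w = c * cochain_inner X k u w"
    by (simp add: cochain_inner_def algebra_simps sum_distrib_left)
  show "cochain_inner X k u v = cochain_inner X k v u"
    by (simp add: cochain_inner_def mult.commute mult.left_commute)
  have "0 \<le> (Ddiag X k \<sigma> * inverse (Bdiag X k \<sigma>)) * (u (orient X \<sigma>))\<^sup>2" if "\<sigma> \<in> cells X k" for \<sigma>
    using weight_pos[OF assms that] by simp
  then show "0 \<le> cochain_inner X k u u"
    by (auto simp: cochain_inner_def power2_eq_square algebra_simps intro!: sum_nonneg)
qed

lemma cochain_inner_definite:
  assumes X: "complex_data X" and u: "u \<in> cochains X k" and 0: "cochain_inner X k u u = 0"
  shows "u = 0"
proof (rule cochain_eq_0I[OF X u])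
  fix \<sigma> assume \<sigma>: "\<sigma> \<in> cells X k"
  let ?g = "\<lambda>\<sigma>. (Ddiag X k \<sigma> * inverse (Bdiag X k \<sigma>)) * (u (orient X \<sigma>))\<^sup>2"
  have "sum ?g (cells X k) = 0"
    using 0 by (simp add: cochain_inner_def power2_eq_square algebra_simps)
  moreover have "0 \<le> ?g \<tau>" if "\<tau> \<in> cells X k" for \<tau>
    using weight_pos[OF X that] by simp
  ultimately have "?g \<sigma> = 0"
    using \<sigma> finite_cells[OF X, of k] by (subst (asm) sum_nonneg_eq_0_iff) auto
  then show "u (orient X \<sigma>) = 0" using weight_pos[OF X \<sigma>] by auto
qed

lemma psd_form_energy:
  assumes "complex_data X"
  shows "psd_form pscale (energy X k)"
proof -
  interpret lower: psd_form pscale "cochain_inner X (k - 1)" by (rule psd_form_cochain_inner[OF assms])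
  interpret upper: psd_form pscale "cochain_inner X (k + 1)" by (rule psd_form_cochain_inner[OF assms])
  interpret d: module_hom pscale pscale "dd X k" by (rule module_hom_dd)
  interpret ds: module_hom pscale pscale "dd_star X (k - 1)" by (rule module_hom_dd_star)
  show ?thesis
  proof
    fix u v w c
    show "energy X k (u + v) w = energy X k u w + energy X k v w"
      by (simp add: energy_def d.add ds.add lower.add_left upper.add_left)
    show "energy X k (pscale c u) w = c * energy X k u w"
      by (simp add: energy_def d.scale ds.scale lower.scale_left upper.scale_left distrib_left)
    show "energy X k u v = energy X k v u"
      unfolding energy_def by (intro arg_cong2[of _ _ _ _ "(+)"] lower.ip_commute upper.ip_commute)
    show "0 \<le> energy X k u u"
      by (simp add: energy_def lower.ip_nonneg upper.ip_nonneg)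
  qed
qed

section \<open>The energy form on the complement of the kernel\<close>

text \<open>
  The two summands of the energy are nonnegative, so both vanish, and the Laplacian of \<open>u\<close> is the
  sum of an image of \<open>d\<^sup>* u = 0\<close> and an image of \<open>d u = 0\<close>. As a member of both the kernel and its
  orthogonal complement, \<open>u\<close> is orthogonal to itself.
\<close>
lemma energy_definite:
  assumes X: "complex_data X" and u: "u \<in> kernel_complement X k" and 0: "energy X k u u = 0"
  shows "u = 0"
proof -
  interpret lower: psd_form pscale "cochain_inner X (k - 1)" by (rule psd_form_cochain_inner[OF X])
  interpret upper: psd_form pscale "cochain_inner X (k + 1)" by (rule psd_form_cochain_inner[OF X])
  have "cochain_inner X (k - 1) (dd_star X (k - 1) u) (dd_star X (k - 1) u) = 0"
    "cochain_inner X (k + 1) (dd X k u) (dd X k u) = 0"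
    using 0 lower.ip_nonneg[of "dd_star X (k - 1) u"] upper.ip_nonneg[of "dd X k u"]
    by (auto simp: energy_def)
  then have "dd_star X (k - 1) u = 0" "dd X k u = 0"
    using cochain_inner_definite[OF X] dd_in_cochains[OF X] dd_star_in_cochains[OF X] by blast+
  then have "hodge_laplacian X k u = 0"
    by (simp add: hodge_laplacian_def module_hom.zero[OF module_hom_dd]
        module_hom.zero[OF module_hom_dd_star])
  then have "cochain_inner X k u u = 0"
    using u by (simp add: kernel_complement_def laplacian_kernel_def)
  then show ?thesis
    using cochain_inner_definite[OF X, of u k] u by (simp add: kernel_complement_def)
qed

lemma subspace_kernel_complement:
  assumes "complex_data X"
  shows "pointwise.subspace (kernel_complement X k)"
proof -
  interpret psd_form pscale "cochain_inner X k" by (rule psd_form_cochain_inner[OF assms])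
  show ?thesis
    using subspace_cochains[of X k]
    by (auto simp: pointwise.subspace_def kernel_complement_def zero_left add_left scale_left)
qed

lemma definite_form_energy:
  assumes X: "complex_data X"
  shows "definite_form pscale (energy X k) (kernel_complement X k)
    ((\<lambda>\<sigma> u. u (orient X \<sigma>)) ` cells X k)"
proof (intro definite_form.intro definite_form_axioms.intro)
  show "psd_form pscale (energy X k)" by (rule psd_form_energy[OF X])
  show "pointwise.subspace (kernel_complement X k)" by (rule subspace_kernel_complement[OF X])
  show "u = 0" if "u \<in> kernel_complement X k" "energy X k u u = 0" for u
    using energy_definite[OF X] that .
  show "finite ((\<lambda>\<sigma> u. u (orient X \<sigma>)) ` cells X k)" using finite_cells[OF X] by simp
  show "module_hom pscale (*) \<phi>" if "\<phi> \<in> (\<lambda>\<sigma> u. u (orient X \<sigma>)) ` cells X k" for \<phi>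
    using that module_hom_evaluation by auto
  show "u = 0" if "u \<in> kernel_complement X k"
    "\<forall>\<phi>\<in>(\<lambda>\<sigma> u. u (orient X \<sigma>)) ` cells X k. \<phi> u = 0" for u
    using that by (intro cochain_eq_0I[OF X, of u k]) (auto simp: kernel_complement_def)
qed

text \<open>
  The supremum defining the dual norm is informative only because its quotients are bounded above:
  with the Riesz representative \<open>g\<close> of \<open>f\<close>, Cauchy-Schwarz bounds them by the energy norm of \<open>g\<close>.
  The quotients at \<open>v\<close> and \<open>- v\<close> are opposite, which makes the supremum nonnegative.
\<close>
lemma dual_energy_norm_bound:
  assumes X: "complex_data X"
  shows "0 \<le> dual_energy_norm X k f"
    and "v \<in> kernel_complement X k \<Longrightarrow>
      cochain_inner X k f v \<le> dual_energy_norm X k f * energy_norm X k v"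
proof -
  let ?V = "kernel_complement X k" and ?r = "\<lambda>v. cochain_inner X k f v / energy_norm X k v"
  interpret C: psd_form pscale "cochain_inner X k" by (rule psd_form_cochain_inner[OF X])
  interpret definite_form pscale "energy X k" ?V "(\<lambda>\<sigma> u. u (orient X \<sigma>)) ` cells X k"
    by (rule definite_form_energy[OF X])
  have nrm: "energy_norm X k = seminorm" by (simp add: fun_eq_iff energy_norm_def seminorm_def)
  obtain g where g: "\<And>v. v \<in> ?V \<Longrightarrow> energy X k g v = cochain_inner X k f v"
    using Riesz[OF C.module_hom_right[of f]] by auto
  have pos: "0 < seminorm v" if "v \<in> ?V" "v \<noteq> 0" for v
    using definite[of v] that ip_nonneg[of v] by (fastforce simp: seminorm_def)
  have "?r v \<le> seminorm g" if "v \<in> ?V - {0}" for v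
    using Cauchy_Schwarz[of g v] g[of v] pos[of v] that by (simp add: nrm field_simps)
  then have bdd: "bdd_above (?r ` (?V - {0}))" by (auto intro!: bdd_aboveI2)
  have upper: "?r v \<le> dual_energy_norm X k f" if "v \<in> ?V" "v \<noteq> 0" for v
    using that cSUP_upper[OF _ bdd, of v] by (auto simp: dual_energy_norm_def)
  show *: "0 \<le> dual_energy_norm X k f"
  proof (cases "?V = {0}")
    case False
    then obtain v where v: "v \<in> ?V" "v \<noteq> 0" using pointwise.subspace_0[OF subspace_V] by blast
    then have "- v \<in> ?V" "- v \<noteq> 0" using pointwise.subspace_neg[OF subspace_V] by auto
    then have "?r v \<le> dual_energy_norm X k f" "- ?r v \<le> dual_energy_norm X k f"
      using upper[of v] upper[of "- v"] v by (auto simp: nrm seminorm_minus C.neg_right)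
    then show ?thesis by linarith
  qed (simp add: dual_energy_norm_def)
  show "cochain_inner X k f v \<le> dual_energy_norm X k f * energy_norm X k v" if "v \<in> ?V"
    using upper[OF that] pos[OF that]
    by (cases "v = 0") (simp_all add: nrm seminorm_zero C.zero_right field_simps)
qed

lemma cochain_norm_dd_star_le:
  assumes "complex_data X"
  shows "cochain_norm X (k - 1) (dd_star X (k - 1) u) \<le> energy_norm X k u"
  using psd_form.ip_nonneg[OF psd_form_cochain_inner[OF assms]]
  by (auto simp: cochain_norm_def energy_norm_def energy_def)

theorem theorem3p6:
  fixes X :: "'v complex_data"
    and k :: int
    and f :: "'v list \<Rightarrow> real"
    and NN :: "('v list \<Rightarrow> real) \<Rightarrow> 'v list \<Rightarrow> real"
    and \<epsilon> L\<^sub>N :: real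
  assumes "complex_data X"
    and "0 \<le> k" and "k \<le> int (dimension X)"
    and "f \<in> cochains X k"
    and "0 < \<epsilon>"
    and "NN \<in> cochains X (k - 1) \<rightarrow> cochains X (k - 1)"
    and "0 < L\<^sub>N"
    and "\<And>v w. v \<in> cochains X (k - 1) \<Longrightarrow> w \<in> cochains X (k - 1) \<Longrightarrow>
           cochain_norm X (k - 1) (NN v - NN w) \<le> L\<^sub>N * cochain_norm X (k - 1) (v - w)"
    and "NN 0 = 0"
    and "\<epsilon> * L\<^sub>N < 1"
  shows "(\<exists>!u. weak_solution X k NN \<epsilon> f u) \<and>
         (\<forall>u. weak_solution X k NN \<epsilon> f u \<longrightarrow>
            energy_norm X k u \<le> dual_energy_norm X k f / (1 - \<epsilon> * L\<^sub>N))"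
proof -
  note X = assms(1)
  let ?V = "kernel_complement X k" and ?ds = "dd_star X (k - 1)"
  interpret C: psd_form pscale "cochain_inner X k" by (rule psd_form_cochain_inner[OF X])
  interpret L: psd_form pscale "cochain_inner X (k - 1)" by (rule psd_form_cochain_inner[OF X])
  interpret definite_form pscale "energy X k" ?V "(\<lambda>\<sigma> u. u (orient X \<sigma>)) ` cells X k"
    by (rule definite_form_energy[OF X])
  interpret ds: module_hom pscale pscale ?ds by (rule module_hom_dd_star)
  have nrm: "energy_norm X k = seminorm" by (simp add: fun_eq_iff energy_norm_def seminorm_def)
  have nrmL: "cochain_norm X (k - 1) = L.seminorm"
    by (simp add: fun_eq_iff cochain_norm_def L.seminorm_def)
  have ds_le: "L.seminorm (?ds u) \<le> seminorm u" for u
    using cochain_norm_dd_star_le[OF X, of k u] by (simp add: nrm nrmL)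
  define N where "N u v = \<epsilon> * cochain_inner X (k - 1) (NN (?ds u)) (?ds v)" for u v
  have hom: "module_hom pscale (*) (N u)" for u
    by unfold_locales
      (simp_all add: N_def ds.add ds.scale L.add_right L.scale_right algebra_simps)
  have Lip: "\<bar>N u v - N w v\<bar> \<le> \<epsilon> * L\<^sub>N * seminorm (u - w) * seminorm v" for u w v
  proof -
    have "\<bar>N u v - N w v\<bar> = \<epsilon> * \<bar>cochain_inner X (k - 1) (NN (?ds u) - NN (?ds w)) (?ds v)\<bar>"
      using assms(5) by (simp add: N_def L.diff_left abs_mult flip: right_diff_distrib)
    also have "\<dots> \<le> \<epsilon> * (L.seminorm (NN (?ds u) - NN (?ds w)) * L.seminorm (?ds v))"
      using assms(5) L.Cauchy_Schwarz by simp
    also have "\<dots> \<le> \<epsilon> * ((L\<^sub>N * seminorm (u - w)) * seminorm v)"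
    proof (intro mult_left_mono mult_mono)
      have "L.seminorm (NN (?ds u) - NN (?ds w)) \<le> L\<^sub>N * L.seminorm (?ds (u - w))"
        using assms(8)[OF dd_star_in_cochains[OF X] dd_star_in_cochains[OF X], of u w]
        by (simp add: nrmL ds.diff)
      also have "\<dots> \<le> L\<^sub>N * seminorm (u - w)"
        using assms(7) ds_le by simp
      finally show "L.seminorm (NN (?ds u) - NN (?ds w)) \<le> L\<^sub>N * seminorm (u - w)" .
    qed (use assms(5,7) ds_le L.seminorm_nonneg seminorm_nonneg in auto)
    finally show ?thesis by (simp add: mult.assoc)
  qed
  have q: "0 \<le> \<epsilon> * L\<^sub>N" using assms(5,7) by simp
  have sol: "weak_solution X k NN \<epsilon> f u \<longleftrightarrow>
      u \<in> ?V \<and> (\<forall>v\<in>?V. energy X k u v + N u v = cochain_inner X k f v)" for u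
    by (simp add: weak_solution_def N_def)
  have "\<exists>!u. weak_solution X k NN \<epsilon> f u"
    unfolding sol by (rule Lipschitz_perturbation[OF C.module_hom_right hom Lip q assms(10)])
  moreover have "seminorm u \<le> dual_energy_norm X k f / (1 - \<epsilon> * L\<^sub>N)"
    if "weak_solution X k NN \<epsilon> f u" for u
  proof -
    have u: "u \<in> ?V" and "energy X k u u + N u u = cochain_inner X k f u"
      using that by (auto simp: sol)
    \<comment> \<open>Compare \<open>u\<close> with the vector 0, at which the nonlinear term vanishes because \<open>NN 0 = 0\<close>.\<close>
    moreover have "\<bar>N u u\<bar> \<le> \<epsilon> * L\<^sub>N * seminorm u * seminorm u"
      using Lip[of u u 0] assms(9) by (simp add: N_def ds.zero L.zero_left)
    moreover have "cochain_inner X k f u \<le> dual_energy_norm X k f * seminorm u"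
      using dual_energy_norm_bound(2)[OF X u] by (simp add: nrm)
    ultimately have "(1 - \<epsilon> * L\<^sub>N) * seminorm u * seminorm u \<le> dual_energy_norm X k f * seminorm u"
      using seminorm_power2[of u] by (simp add: power2_eq_square algebra_simps)
    then have "(1 - \<epsilon> * L\<^sub>N) * seminorm u \<le> dual_energy_norm X k f"
      using seminorm_nonneg[of u] dual_energy_norm_bound(1)[OF X, of k f]
      by (cases "seminorm u = 0") auto
    then show ?thesis using assms(10) by (simp add: field_simps)
  qed
  ultimately show ?thesis by (simp add: nrm)
qed

end
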